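(* Let $X$ be a Zariski space, and let $\mu$ be a finite signed Borel measure on $X$. Then $\mu$ can be written uniquely as an absolutely convergent sum $\mu=\sum_{x\in X}c_x\delta_x$, where the $c_x$ are real numbers and $\delta_x$ is the Dirac probability measure at $x$.
   Context: A topological space $X$ is Noetherian if every descending chain of closed subsets is eventually constant. A closed set $E\subseteq X$ is irreducible if it is not a union $E=E_1\cup E_2$ of two proper closed subsets. A Noetherian space $X$ is a Zariski space if every nonempty irreducible closed subset $E\subseteq X$ has a unique generic point, i.e. a unique point $x\in E$ with $\overline{\{x\}}=E$. Borel measures are measures on the $\sigma$-algebra generated by the closed (equivalently open) sets. *)

theory Defs
  imports "HOL-Probability.Probability"
begin

definition noetherian_space :: "'a topology \<Rightarrow> bool" where
  "noetherian_space X \<longleftrightarrow>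
     (\<forall>F :: nat \<Rightarrow> 'a set. (\<forall>n. closedin X (F n)) \<and> decseq F \<longrightarrow> (\<exists>N. \<forall>n\<ge>N. F n = F N))"

text \<open>The empty set is irreducible in this sense; nonemptiness is imposed separately.\<close>

definition irreducible_closedin :: "'a topology \<Rightarrow> 'a set \<Rightarrow> bool" where
  "irreducible_closedin X E \<longleftrightarrow>
     closedin X E \<and>
     \<not> (\<exists>E1 E2. closedin X E1 \<and> closedin X E2 \<and> E1 \<subset> E \<and> E2 \<subset> E \<and> E = E1 \<union> E2)"

definition zariski_space :: "'a topology \<Rightarrow> bool" where
  "zariski_space X \<longleftrightarrow>
     noetherian_space X \<and>
     (\<forall>E. irreducible_closedin X E \<and> E \<noteq> {} \<longrightarrow> (\<exists>!x. x \<in> E \<and> X closure_of {x} = E))"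

text \<open>The Borel \<open>\<sigma>\<close>-algebra of an abstract topology, as a measurable space; the library's
  \<^const>\<open>borel\<close> is only available for type class topologies.\<close>

definition borel_space_of :: "'a topology \<Rightarrow> 'a measure" where
  "borel_space_of X = sigma (topspace X) {C. closedin X C}"

text \<open>Real-valued countably additive set functions on the \<open>\<sigma>\<close>-algebra of \<open>M\<close> (the measure carried
  by \<open>M\<close> itself plays no role). Values on nonmeasurable sets are irrelevant and unconstrained.\<close>

definition finite_signed_measure :: "'a measure \<Rightarrow> ('a set \<Rightarrow> real) \<Rightarrow> bool" where
  "finite_signed_measure M \<mu> \<longleftrightarrow>
     \<mu> {} = 0 \<and>
     (\<forall>A :: nat \<Rightarrow> 'a set. range A \<subseteq> sets M \<and> disjoint_family A \<longrightarrow>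
        (\<lambda>i. \<mu> (A i)) sums \<mu> (\<Union>i. A i))"

end

theory Submission
  imports Defs
begin

text \<open>Let \<open>E\<close> be the closure of a point \<open>x\<close>. Modulo countable unions of closed sets missing \<open>x\<close>,
  every Borel subset of \<open>E\<close> is either empty or all of \<open>E\<close>, according to whether it contains
  \<open>x\<close>. An exhaustion argument gives one such union \<open>Z\<close> outside of which \<open>\<mu>\<close> vanishes on all the
  others, so \<open>\<mu>\<close> restricted to \<open>E - Z\<close> behaves like a multiple \<open>c x\<close> of the Dirac measure at
  \<open>x\<close>. For finitely many points the sets \<open>E - Z\<close> can be made disjoint, hence \<open>c\<close> is absolutely
  summable because \<open>\<mu>\<close> is bounded; Noetherian induction on closed sets then shows that \<open>\<mu>\<close> and
  the sum of the point masses agree.\<close>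

section \<open>Finite signed measures\<close>

lemma finite_signed_measure_empty: "finite_signed_measure M \<mu> \<Longrightarrow> \<mu> {} = 0"
  by (simp add: finite_signed_measure_def)

lemma finite_signed_measure_sums:
  fixes A :: "nat \<Rightarrow> 'a set"
  assumes "finite_signed_measure M \<mu>" "range A \<subseteq> sets M" "disjoint_family A"
  shows "(\<lambda>i. \<mu> (A i)) sums \<mu> (\<Union>i. A i)"
  using assms by (simp add: finite_signed_measure_def)

lemma finite_signed_measure_uminus:
  "finite_signed_measure M \<mu> \<Longrightarrow> finite_signed_measure M (\<lambda>A. - \<mu> A)"
  by (simp add: finite_signed_measure_def sums_minus)

lemma finite_signed_measure_diff:
  "finite_signed_measure M \<mu> \<Longrightarrow> finite_signed_measure M \<nu> \<Longrightarrow>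
   finite_signed_measure M (\<lambda>A. \<mu> A - \<nu> A)"
  by (simp add: finite_signed_measure_def sums_diff)

lemma finite_signed_measure_Un:
  assumes "finite_signed_measure M \<mu>" "A \<in> sets M" "B \<in> sets M" "A \<inter> B = {}"
  shows "\<mu> (A \<union> B) = \<mu> A + \<mu> B"
proof -
  have "range (binaryset A B) \<subseteq> sets M"
    using assms(2,3) by (simp add: range_binaryset_eq)
  moreover have "disjoint_family (binaryset A B)"
    unfolding disjoint_family_on_def binaryset_def fun_upd_def
    using assms(4) by (simp add: Int_commute)
  ultimately have "(\<lambda>n. \<mu> (binaryset A B n)) sums \<mu> (A \<union> B)"
    using finite_signed_measure_sums[OF assms(1), of "binaryset A B"] by (simp add: UN_binaryset_eq)
  moreover have "(\<lambda>n. \<mu> (binaryset A B n)) sums (\<mu> A + \<mu> B)"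
    by (rule binaryset_sums) (rule finite_signed_measure_empty[OF assms(1)])
  ultimately show ?thesis
    by (rule sums_unique2)
qed

lemma finite_signed_measure_split:
  assumes "finite_signed_measure M \<mu>" "A \<in> sets M" "B \<in> sets M"
  shows "\<mu> A = \<mu> (A \<inter> B) + \<mu> (A - B)"
proof -
  have "\<mu> ((A \<inter> B) \<union> (A - B)) = \<mu> (A \<inter> B) + \<mu> (A - B)"
    using assms by (intro finite_signed_measure_Un[OF assms(1)]) auto
  then show ?thesis
    by (simp only: Int_Diff_Un)
qed

lemma finite_signed_measure_finite_UN:
  assumes "finite_signed_measure M \<mu>" "finite I"
    and "\<And>i. i \<in> I \<Longrightarrow> A i \<in> sets M" "disjoint_family_on A I"
  shows "\<mu> (\<Union>i\<in>I. A i) = (\<Sum>i\<in>I. \<mu> (A i))"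
  using assms(2-4)
proof (induction I rule: finite_induct)
  case empty
  then show ?case using finite_signed_measure_empty[OF assms(1)] by simp
next
  case (insert i I)
  have "\<mu> (A i \<union> (\<Union>j\<in>I. A j)) = \<mu> (A i) + \<mu> (\<Union>j\<in>I. A j)"
    using insert.prems insert.hyps
    by (intro finite_signed_measure_Un[OF assms(1)])
       (auto simp: disjoint_family_on_def)
  moreover have "disjoint_family_on A I"
    using insert.prems(2) by (auto simp: disjoint_family_on_def)
  ultimately show ?case
    using insert.IH insert.hyps insert.prems(1) by (simp del: UN_simps)
qed

text \<open>If \<open>\<mu>\<close> were unbounded on the subsets of \<open>A\<close>, one could split off a piece of measure at
  least 1 in absolute value from \<open>A\<close> while staying unbounded on the rest; iterating this
  contradicts countable additivity.\<close>

lemma finite_signed_measure_bounded: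
  assumes fsm: "finite_signed_measure M \<mu>"
  shows "\<exists>K. \<forall>A\<in>sets M. \<bar>\<mu> A\<bar> \<le> K"
proof (rule ccontr)
  define bad where
    "bad A \<longleftrightarrow> A \<in> sets M \<and> (\<forall>K. \<exists>B\<in>sets M. B \<subseteq> A \<and> \<bar>\<mu> B\<bar> > K)" for A
  assume "\<nexists>K. \<forall>A\<in>sets M. \<bar>\<mu> A\<bar> \<le> K"
  then have "\<exists>B\<in>sets M. B \<subseteq> space M \<and> \<bar>\<mu> B\<bar> > K" for K
    by (meson not_le sets.sets_into_space)
  then have "bad (space M)"
    by (simp add: bad_def)
  have step: "\<exists>B. bad B \<and> B \<subseteq> A \<and> 1 \<le> \<bar>\<mu> (A - B)\<bar>" if "bad A" for A
  proof -
    have A: "A \<in> sets M" using that by (simp add: bad_def)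
    \<comment> \<open>The margin \<open>\<bar>\<mu> A\<bar> + 1\<close> makes both
      \<open>\<mu> B\<close> and \<open>\<mu> (A - B)\<close> at least 1 in absolute value, so
      whichever half is still bad can be kept.\<close>
    have "\<exists>B\<in>sets M. B \<subseteq> A \<and> \<bar>\<mu> B\<bar> > \<bar>\<mu> A\<bar> + 1"
      using that by (simp add: bad_def)
    then obtain B where B: "B \<in> sets M" "B \<subseteq> A" "\<bar>\<mu> B\<bar> > \<bar>\<mu> A\<bar> + 1"
      by blast
    have split: "\<mu> A = \<mu> B + \<mu> (A - B)"
      using finite_signed_measure_split[OF fsm A B(1)] B(2) by (simp add: Int_absorb1)
    have "bad B \<or> bad (A - B)"
    proof (rule ccontr)
      assume "\<not> (bad B \<or> bad (A - B))"
      then obtain K1 K2 where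
        K1: "\<And>C. C \<in> sets M \<Longrightarrow> C \<subseteq> B \<Longrightarrow> \<bar>\<mu> C\<bar> \<le> K1" and
        K2: "\<And>C. C \<in> sets M \<Longrightarrow> C \<subseteq> A - B \<Longrightarrow> \<bar>\<mu> C\<bar> \<le> K2"
        using A B(1) sets.Diff[OF A B(1)] unfolding bad_def by (meson not_le)
      have "\<bar>\<mu> C\<bar> \<le> K1 + K2" if C: "C \<in> sets M" "C \<subseteq> A" for C
      proof -
        have "\<bar>\<mu> (C \<inter> B)\<bar> \<le> K1" "\<bar>\<mu> (C - B)\<bar> \<le> K2"
          using C B(1) by (auto intro!: K1 K2)
        then show ?thesis
          using finite_signed_measure_split[OF fsm C(1) B(1)] by linarith
      qed
      then show False
        using \<open>bad A\<close> unfolding bad_def by (meson not_le)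
    qed
    then show ?thesis
    proof
      assume "bad B"
      then show ?thesis
        using B split by (intro exI[of _ B]) auto
    next
      assume "bad (A - B)"
      moreover have "A - (A - B) = B" using B(2) by blast
      ultimately show ?thesis
        using B by (intro exI[of _ "A - B"]) auto
    qed
  qed
  have "\<exists>A. \<forall>n. bad (A n) \<and> (A (Suc n) \<subseteq> A n \<and> 1 \<le> \<bar>\<mu> (A n - A (Suc n))\<bar>)"
    by (rule dependent_nat_choice) (use \<open>bad (space M)\<close> step in auto)
  then obtain A where A: "\<And>n. bad (A n)" "\<And>n. A (Suc n) \<subseteq> A n \<and> 1 \<le> \<bar>\<mu> (A n - A (Suc n))\<bar>"
    by metis
  define D where "D n = A n - A (Suc n)" for n
  have dec: "A n \<subseteq> A m" if "m \<le> n" for m n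
    using A(2) that lift_Suc_antimono_le[of A m n] by blast
  have "D m \<inter> D n = {}" if "m < n" for m n
    using dec[of "Suc m" n] that by (auto simp: D_def)
  then have "disjoint_family D"
    unfolding disjoint_family_on_def by (metis Int_commute nat_neq_iff)
  moreover have "range D \<subseteq> sets M"
    using A(1) by (auto simp: D_def bad_def)
  ultimately have "summable (\<lambda>n. \<mu> (D n))"
    using finite_signed_measure_sums[OF fsm] by (blast intro: sums_summable)
  then have "(\<lambda>n. \<mu> (D n)) \<longlonglongrightarrow> 0"
    by (rule summable_LIMSEQ_zero)
  then obtain n where "\<bar>\<mu> (D n)\<bar> < 1"
    using LIMSEQ_D[of _ 0 1] by fastforce
  then show False
    using A(2)[of n] by (simp add: D_def)
qed

section \<open>Null sets and exhaustion for signed measures\<close>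

lemma finite_signed_measure_null_Union:
  assumes fsm: "finite_signed_measure M \<mu>" and "countable \<F>" "\<F> \<subseteq> sets M"
    and null: "\<And>F B. F \<in> \<F> \<Longrightarrow> B \<in> sets M \<Longrightarrow> B \<subseteq> F \<Longrightarrow> \<mu> B = 0"
    and B: "B \<in> sets M" "B \<subseteq> \<Union>\<F>"
  shows "\<mu> B = 0"
proof (cases "\<F> = {}")
  case True
  then show ?thesis using B(2) finite_signed_measure_empty[OF fsm] by simp
next
  case False
  \<comment> \<open>Each disjointed piece lies inside a single member of \<open>\<F>\<close>.
    Nullity is assumed for all measurable subsets of a member because cancellation lets
    \<open>\<mu> F = 0\<close> hold while subsets of \<open>F\<close> have nonzero measure.\<close>
  define D where "D = disjointed (\<lambda>n. B \<inter> from_nat_into \<F> n)"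
  have mem: "from_nat_into \<F> n \<in> \<F>" for n
    using False by (rule from_nat_into)
  have sub: "range (\<lambda>n. B \<inter> from_nat_into \<F> n) \<subseteq> sets M"
    using mem assms(3) B(1) by blast
  have D: "range D \<subseteq> sets M"
    unfolding D_def by (rule sets.range_disjointed_sets[OF sub])
  have "(\<Union>n. D n) = B \<inter> (\<Union>n. from_nat_into \<F> n)"
    unfolding D_def UN_disjointed_eq by blast
  also have "\<dots> = B"
    using range_from_nat_into[OF False \<open>countable \<F>\<close>] B(2) by auto
  finally have "(\<lambda>n. \<mu> (D n)) sums \<mu> B"
    using finite_signed_measure_sums[OF fsm D] by (simp add: D_def disjoint_family_disjointed)
  moreover have "\<mu> (D n) = 0" for n
    using D mem[of n] disjointed_subset[of "\<lambda>n. B \<inter> from_nat_into \<F> n" n]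
    by (intro null[of "from_nat_into \<F> n"]) (auto simp: D_def)
  ultimately show ?thesis
    using sums_unique2[OF sums_zero, of "\<mu> B"] by simp
qed

text \<open>Boundedness makes the supremum of \<open>\<mu>\<close> over measurable sets lying in
  members of \<open>I\<close> finite. Let \<open>Z\<close> be the union of members containing sets
  that nearly attain it: a set of positive measure outside \<open>Z\<close> but inside a member
  could be added to a near maximiser and would exceed the supremum.\<close>

lemma finite_signed_measure_exhaustion_le:
  assumes fsm: "finite_signed_measure M \<mu>"
    and I: "I \<subseteq> sets M" "{} \<in> I" "\<And>Z. range Z \<subseteq> I \<Longrightarrow> (\<Union>n::nat. Z n) \<in> I"
  shows "\<exists>Z\<in>I. \<forall>Z'\<in>I. \<forall>B\<in>sets M. B \<subseteq> Z' - Z \<longrightarrow> \<mu> B \<le> 0"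
proof -
  define V where "V = {\<mu> B |B. B \<in> sets M \<and> (\<exists>Z\<in>I. B \<subseteq> Z)}"
  obtain K where K: "\<And>A. A \<in> sets M \<Longrightarrow> \<bar>\<mu> A\<bar> \<le> K"
    using finite_signed_measure_bounded[OF fsm] by blast
  have bdd: "bdd_above V"
    using K by (fastforce simp: V_def intro!: bdd_aboveI[of _ K])
  have ne: "V \<noteq> {}"
    using I(2) by (auto simp: V_def)
  have "\<exists>B Z. B \<in> sets M \<and> Z \<in> I \<and> B \<subseteq> Z \<and> Sup V - 1 / Suc n < \<mu> B" for n :: nat
  proof -
    have "Sup V - 1 / Suc n < Sup V" by simp
    then obtain v where "v \<in> V" "Sup V - 1 / Suc n < v"
      using less_cSup_iff[OF ne bdd] by blast
    then show ?thesis by (auto simp: V_def)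
  qed
  then obtain B Z where BZ: "\<And>n::nat. B n \<in> sets M" "\<And>n. Z n \<in> I" "\<And>n. B n \<subseteq> Z n"
    "\<And>n. Sup V - 1 / Suc n < \<mu> (B n)"
    by metis
  have "\<mu> C \<le> 0" if C: "Z' \<in> I" "C \<in> sets M" "C \<subseteq> Z' - (\<Union>n. Z n)" for Z' C
  proof -
    have "\<mu> C \<le> 1 / Suc n" for n
    proof -
      \<comment> \<open>Closure of \<open>I\<close> is assumed for sequences only, so a binary union
        is written as the union of a sequence with two values.\<close>
      have "Z' \<union> Z n = (\<Union>k::nat. if k = 0 then Z' else Z n)"
        by (auto split: if_splits intro: exI[of _ 0] exI[of _ "1::nat"])
      also have "\<dots> \<in> I"
        using C(1) BZ(2) by (intro I(3)) auto
      finally have "\<mu> (C \<union> B n) \<in> V"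
        unfolding V_def using C BZ(1,3)[of n]
        by (auto intro!: exI[of _ "C \<union> B n"] bexI[of _ "Z' \<union> Z n"])
      then have "\<mu> (C \<union> B n) \<le> Sup V"
        using bdd by (rule cSup_upper)
      moreover have "\<mu> (C \<union> B n) = \<mu> C + \<mu> (B n)"
        using C BZ(1,3)[of n] by (intro finite_signed_measure_Un[OF fsm]) auto
      ultimately show ?thesis
        using BZ(4)[of n] by linarith
    qed
    then show ?thesis
      using LIMSEQ_le_const[OF LIMSEQ_inverse_real_of_nat, of "\<mu> C"]
      by (auto simp: inverse_eq_divide)
  qed
  then show ?thesis
    using I(3)[of Z] BZ(2) by blast
qed

text \<open>The one-sided version is applied to \<open>\<mu>\<close> and to its negative; outside
  the union of the two resulting sets both inequalities hold.\<close>

lemma finite_signed_measure_exhaustion: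
  assumes fsm: "finite_signed_measure M \<mu>"
    and I: "I \<subseteq> sets M" "{} \<in> I" "\<And>Z. range Z \<subseteq> I \<Longrightarrow> (\<Union>n::nat. Z n) \<in> I"
  shows "\<exists>Z\<in>I. \<forall>Z'\<in>I. \<forall>B\<in>sets M. B \<subseteq> Z' - Z \<longrightarrow> \<mu> B = 0"
proof -
  obtain Z1 where Z1: "Z1 \<in> I"
    "\<And>Z' B. Z' \<in> I \<Longrightarrow> B \<in> sets M \<Longrightarrow> B \<subseteq> Z' - Z1 \<Longrightarrow> \<mu> B \<le> 0"
    using finite_signed_measure_exhaustion_le[OF fsm I(1,2)] I(3) by metis
  obtain Z2 where Z2: "Z2 \<in> I"
    "\<And>Z' B. Z' \<in> I \<Longrightarrow> B \<in> sets M \<Longrightarrow> B \<subseteq> Z' - Z2 \<Longrightarrow> - \<mu> B \<le> 0"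
    using finite_signed_measure_exhaustion_le[OF finite_signed_measure_uminus[OF fsm] I(1,2)] I(3)
    by metis
  have "Z1 \<union> Z2 = (\<Union>k::nat. if k = 0 then Z1 else Z2)"
    by (auto split: if_splits intro: exI[of _ 0] exI[of _ "1::nat"])
  also have "\<dots> \<in> I"
    using Z1(1) Z2(1) by (intro I(3)) auto
  finally have "Z1 \<union> Z2 \<in> I" .
  moreover have "\<mu> B = 0" if "Z' \<in> I" "B \<in> sets M" "B \<subseteq> Z' - (Z1 \<union> Z2)" for Z' B
    using Z1(2)[of Z' B] Z2(2)[of Z' B] that by fastforce
  ultimately show ?thesis by blast
qed

section \<open>Sums of point masses as signed measures\<close>

lemma abs_summable_on_real_iff:
  fixes f :: "'a \<Rightarrow> real"
  shows "(\<lambda>x. \<bar>f x\<bar>) summable_on A \<longleftrightarrow> f summable_on A"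
  using summable_on_iff_abs_summable_on_real[of f A] by simp

lemma finite_signed_measure_infsum:
  fixes c :: "'a \<Rightarrow> real"
  assumes "c summable_on space M"
  shows "finite_signed_measure M (infsum c)"
  unfolding finite_signed_measure_def
proof (intro conjI allI impI)
  show "infsum c {} = 0" by simp
  fix A :: "nat \<Rightarrow> 'a set"
  assume A: "range A \<subseteq> sets M \<and> disjoint_family A"
  have sum: "c summable_on S" if "S \<subseteq> space M" for S
    using assms that by (rule summable_on_subset_banach)
  have sub: "A i \<subseteq> space M" for i
    using A sets.sets_into_space by blast
  \<comment> \<open>Disjointness turns the sum over the union into a double sum over pairs of an
    index and a point, which can then be grouped by index.\<close>
  have inj: "inj_on snd (Sigma UNIV A)"
  proof (rule inj_onI)
    fix p q assume pq: "p \<in> Sigma UNIV A" "q \<in> Sigma UNIV A" "snd p = snd q"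
    then have "snd p \<in> A (fst p) \<inter> A (fst q)" by auto
    then have "fst p = fst q"
      using A by (metis disjoint_family_onD UNIV_I empty_iff)
    with pq(3) show "p = q" by (simp add: prod_eq_iff)
  qed
  have im: "snd ` Sigma UNIV A = (\<Union>i. A i)"
    by force
  have "(c has_sum infsum c (\<Union>i. A i)) (\<Union>i. A i)"
    using sub by (intro has_sum_infsum sum) blast
  then have "((c \<circ> snd) has_sum infsum c (\<Union>i. A i)) (Sigma UNIV A)"
    using has_sum_reindex[OF inj, of c] im by metis
  then have "((\<lambda>i. infsum c (A i)) has_sum infsum c (\<Union>i. A i)) UNIV"
    by (rule has_sum_Sigma') (use sub sum in \<open>auto intro: has_sum_infsum\<close>)
  then show "(\<lambda>i. infsum c (A i)) sums infsum c (\<Union>i. A i)"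
    by (rule has_sum_imp_sums)
qed

section \<open>Borel sets near a point\<close>

lemma space_borel_space_of: "space (borel_space_of X) = topspace X"
  unfolding borel_space_of_def by (rule space_measure_of) (auto dest: closedin_subset)

lemma sets_borel_space_of: "sets (borel_space_of X) = sigma_sets (topspace X) {C. closedin X C}"
  unfolding borel_space_of_def by (rule sets_measure_of) (auto dest: closedin_subset)

lemma closedin_borel_space_of: "closedin X C \<Longrightarrow> C \<in> sets (borel_space_of X)"
  unfolding sets_borel_space_of by (rule sigma_sets.Basic) simp

lemma subset_topspace_borel_space_of: "A \<in> sets (borel_space_of X) \<Longrightarrow> A \<subseteq> topspace X"
  using sets.sets_into_space space_borel_space_of by metis

text \<open>These are the exceptional sets at \<open>x\<close>. They are closed under countable
  unions and never contain \<open>x\<close>, and each closed piece meets the closure of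
  \<open>x\<close> in a proper closed subset when \<open>x\<close> is a point of the space, which is
  what Noetherian induction needs.\<close>

definition closed_sigma_avoiding :: "'a topology \<Rightarrow> 'a \<Rightarrow> 'a set set" where
  "closed_sigma_avoiding X x =
     {\<Union>\<F> |\<F>. countable \<F> \<and> (\<forall>F\<in>\<F>. closedin X F \<and> x \<notin> F)}"

lemma closed_sigma_avoiding_closedin:
  "closedin X F \<Longrightarrow> x \<notin> F \<Longrightarrow> F \<in> closed_sigma_avoiding X x"
  unfolding closed_sigma_avoiding_def by (auto intro!: exI[of _ "{F}"])

lemma closed_sigma_avoiding_empty: "{} \<in> closed_sigma_avoiding X x"
  by (rule closed_sigma_avoiding_closedin) auto

lemma closed_sigma_avoiding_UN:
  assumes "countable I" "\<And>i. i \<in> I \<Longrightarrow> Z i \<in> closed_sigma_avoiding X x"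
  shows "(\<Union>i\<in>I. Z i) \<in> closed_sigma_avoiding X x"
proof -
  obtain \<F> where \<F>: "\<And>i. i \<in> I \<Longrightarrow> Z i = \<Union>(\<F> i)" "\<And>i. i \<in> I \<Longrightarrow> countable (\<F> i)"
    "\<And>i F. i \<in> I \<Longrightarrow> F \<in> \<F> i \<Longrightarrow> closedin X F \<and> x \<notin> F"
    using assms(2) unfolding closed_sigma_avoiding_def mem_Collect_eq by metis
  have "(\<Union>i\<in>I. Z i) = \<Union>(\<Union>i\<in>I. \<F> i)"
    using \<F>(1) by auto
  moreover have "countable (\<Union>i\<in>I. \<F> i)"
    using assms(1) \<F>(2) by blast
  moreover have "\<forall>F\<in>(\<Union>i\<in>I. \<F> i). closedin X F \<and> x \<notin> F"
    using \<F>(3) by simp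
  ultimately show ?thesis
    unfolding closed_sigma_avoiding_def by (intro CollectI exI[of _ "\<Union>i\<in>I. \<F> i"] conjI)
qed

lemma closed_sigma_avoiding_Un:
  assumes "Z \<in> closed_sigma_avoiding X x" "Z' \<in> closed_sigma_avoiding X x"
  shows "Z \<union> Z' \<in> closed_sigma_avoiding X x"
  using closed_sigma_avoiding_UN[of "{Z, Z'}" id X x] assms by auto

lemma closed_sigma_avoiding_borel:
  assumes "Z \<in> closed_sigma_avoiding X x"
  shows "Z \<in> sets (borel_space_of X)"
proof -
  obtain \<F> where \<F>: "Z = \<Union>\<F>" "countable \<F>" "\<And>F. F \<in> \<F> \<Longrightarrow> closedin X F"
    using assms unfolding closed_sigma_avoiding_def by blast
  then have "\<F> \<subseteq> sets (borel_space_of X)"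
    using closedin_borel_space_of by blast
  with \<F>(1,2) show ?thesis
    using sets.countable_Union by simp
qed

lemma mem_closure_of_singleton: "x \<in> topspace X \<Longrightarrow> x \<in> X closure_of {x}"
  using closure_of_subset[of "{x}" X] by auto

lemma closure_of_singleton_subset: "closedin X C \<Longrightarrow> x \<in> C \<Longrightarrow> X closure_of {x} \<subseteq> C"
  by (rule closure_of_minimal) auto

text \<open>Induction over the generation of the Borel sets. A closed set containing
  \<open>x\<close> contains the whole closure, and one missing \<open>x\<close> is itself an
  admissible exceptional set. Complements keep the exceptional set; countable unions take the union
  of the exceptional sets.\<close>

lemma borel_dichotomy_closure:
  assumes "A \<in> sets (borel_space_of X)" "x \<in> topspace X"
  shows "\<exists>Z\<in>closed_sigma_avoiding X x. \<forall>y\<in>X closure_of {x} - Z. y \<in> A \<longleftrightarrow> x \<in> A"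
  using assms(1) unfolding sets_borel_space_of
proof (induction rule: sigma_sets.induct)
  case (Basic C)
  then have C: "closedin X C" by simp
  show ?case
  proof (cases "x \<in> C")
    case True
    then have "X closure_of {x} \<subseteq> C"
      using C by (intro closure_of_singleton_subset)
    then show ?thesis
      using True closed_sigma_avoiding_empty by (intro bexI[of _ "{}"]) auto
  next
    case False
    then show ?thesis
      using C closed_sigma_avoiding_closedin[of X C x] by blast
  qed
next
  case Empty
  show ?case using closed_sigma_avoiding_empty by (intro bexI[of _ "{}"]) auto
next
  case (Compl A)
  then show ?case
    using assms(2) closure_of_subset_topspace[of X "{x}"] by blast
next
  case (Union A)
  then obtain Z where Z: "\<And>i. Z i \<in> closed_sigma_avoiding X x"
    "\<And>i y. y \<in> X closure_of {x} - Z i \<Longrightarrow> y \<in> A i \<longleftrightarrow> x \<in> A i"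
    by metis
  have "(\<Union>i. Z i) \<in> closed_sigma_avoiding X x"
    using Z(1) by (intro closed_sigma_avoiding_UN) auto
  then show ?case
    using Z(2) by (intro bexI[of _ "\<Union>i. Z i"]) auto
qed

text \<open>The coefficient \<open>c\<close> cannot be defined as \<open>\<mu> {x}\<close>, since \<open>{x}\<close> need not be a Borel set.\<close>

lemma point_mass_exists:
  assumes fsm: "finite_signed_measure (borel_space_of X) \<mu>" and x: "x \<in> topspace X"
  shows "\<exists>c Z. Z \<in> closed_sigma_avoiding X x \<and>
           (\<forall>Z'\<in>closed_sigma_avoiding X x. \<forall>A\<in>sets (borel_space_of X).
              Z \<subseteq> Z' \<and> A \<subseteq> X closure_of {x} \<longrightarrow> \<mu> (A - Z') = (if x \<in> A then c else 0))"
proof -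
  let ?M = "borel_space_of X" and ?N = "closed_sigma_avoiding X x" and ?E = "X closure_of {x}"
  have "\<exists>Z\<in>?N. \<forall>Z'\<in>?N. \<forall>B\<in>sets ?M. B \<subseteq> Z' - Z \<longrightarrow> \<mu> B = 0"
  proof (rule finite_signed_measure_exhaustion[OF fsm])
    show "?N \<subseteq> sets ?M" by (rule subsetI) (rule closed_sigma_avoiding_borel)
    show "{} \<in> ?N" by (rule closed_sigma_avoiding_empty)
    show "(\<Union>n::nat. Z n) \<in> ?N" if "range Z \<subseteq> ?N" for Z
      using that by (intro closed_sigma_avoiding_UN) auto
  qed
  then obtain Z where Z: "Z \<in> ?N"
    and null: "\<And>Z' B. Z' \<in> ?N \<Longrightarrow> B \<in> sets ?M \<Longrightarrow> B \<subseteq> Z' - Z \<Longrightarrow> \<mu> B = 0"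
    by metis
  have E: "?E \<in> sets ?M"
    by (intro closedin_borel_space_of) simp
  \<comment> \<open>By the dichotomy, a Borel subset of \<open>?E\<close> missing \<open>x\<close>
    is contained in some exceptional \<open>Z'\<close>, so \<open>B - Z\<close> falls under the
    exhaustion property of \<open>Z\<close>.\<close>
  have away: "\<mu> (B - Z) = 0" if B: "B \<in> sets ?M" "B \<subseteq> ?E" "x \<notin> B" for B
  proof -
    obtain Z' where "Z' \<in> ?N" "\<And>y. y \<in> ?E - Z' \<Longrightarrow> y \<in> B \<longleftrightarrow> x \<in> B"
      using borel_dichotomy_closure[OF B(1) x] by blast
    then show ?thesis
      using B Z by (intro null[of Z']) (auto intro: closed_sigma_avoiding_borel)
  qed
  \<comment> \<open>The coefficient is \<open>\<mu> (?E - Z)\<close>. Allowing every larger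
    \<open>Z'\<close> lets closures of further points be removed later without changing the mass;
    enlarging \<open>Z\<close> only discards a null set.\<close>
  have eq: "\<mu> (A - Z') = (if x \<in> A then \<mu> (?E - Z) else 0)"
    if Z': "Z' \<in> ?N" "Z \<subseteq> Z'" and A: "A \<in> sets ?M" "A \<subseteq> ?E" for Z' A
  proof -
    have ZM: "Z \<in> sets ?M" "Z' \<in> sets ?M"
      using Z Z' by (auto intro: closed_sigma_avoiding_borel)
    have "\<mu> ((A - Z) \<inter> Z') = 0"
      using A Z' ZM by (intro null[of Z']) auto
    moreover have "(A - Z) - Z' = A - Z'" using Z'(2) by blast
    ultimately have 1: "\<mu> (A - Z) = \<mu> (A - Z')"
      using finite_signed_measure_split[OF fsm, of "A - Z" Z'] A ZM by auto
    show ?thesis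
    proof (cases "x \<in> A")
      case True
      have "\<mu> ((?E - A) - Z) = 0"
        using A E True by (intro away) auto
      moreover have "(?E - Z) \<inter> A = A - Z" "(?E - Z) - A = (?E - A) - Z"
        using A(2) by auto
      ultimately show ?thesis
        using finite_signed_measure_split[OF fsm, of "?E - Z" A] A E ZM 1 True by auto
    next
      case False
      then show ?thesis using away[OF A] 1 by simp
    qed
  qed
  show ?thesis
    using Z eq by (intro exI[of _ "\<mu> (?E - Z)"] exI[of _ Z]) blast
qed

section \<open>Zariski spaces\<close>

text \<open>The closure of \<open>x\<close> is irreducible, since a closed part containing
  \<open>x\<close> is already everything. Under the assumptions \<open>x\<close> and
  \<open>y\<close> have the same closure, so both are its generic point.\<close>

lemma zariski_space_T0:
  assumes "zariski_space X" "x \<in> topspace X" "y \<in> topspace X"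
    "x \<in> X closure_of {y}" "y \<in> X closure_of {x}"
  shows "x = y"
proof -
  have eq: "X closure_of {x} = X closure_of {y}"
    using assms(4,5) by (intro subset_antisym closure_of_singleton_subset) auto
  have mem: "x \<in> X closure_of {x}"
    using assms(2) by (rule mem_closure_of_singleton)
  have "irreducible_closedin X (X closure_of {x})"
    unfolding irreducible_closedin_def
  proof (intro conjI notI)
    assume "\<exists>E1 E2. closedin X E1 \<and> closedin X E2 \<and> E1 \<subset> X closure_of {x} \<and>
      E2 \<subset> X closure_of {x} \<and> X closure_of {x} = E1 \<union> E2"
    then show False
      using mem closure_of_singleton_subset[of X _ x] by blast
  qed simp
  then have "\<exists>!z. z \<in> X closure_of {x} \<and> X closure_of {z} = X closure_of {x}"
    using assms(1) mem unfolding zariski_space_def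
    by (elim conjE allE[of _ "X closure_of {x}"]) auto
  then show ?thesis
    using assms(5) eq mem by metis
qed

text \<open>Remove the closures of all \<open>y\<close> in \<open>S\<close> that do not have
  \<open>x\<close> in their closure. A point of \<open>S\<close> left in the closure of
  \<open>x\<close> then specialises to \<open>x\<close> and conversely, so it equals
  \<open>x\<close>.\<close>

lemma zariski_space_isolate_point:
  assumes zariski: "zariski_space X" and x: "x \<in> topspace X"
    and S: "countable S" "S \<subseteq> topspace X"
  obtains T where "T \<in> closed_sigma_avoiding X x" "S \<inter> X closure_of {x} - T \<subseteq> {x}"
proof
  let ?T = "\<Union>y\<in>{y\<in>S. x \<notin> X closure_of {y}}. X closure_of {y}"
  show "?T \<in> closed_sigma_avoiding X x"
    using S(1) by (intro closed_sigma_avoiding_UN)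
      (auto intro: closed_sigma_avoiding_closedin countable_subset)
  show "S \<inter> X closure_of {x} - ?T \<subseteq> {x}"
  proof
    fix y assume y: "y \<in> S \<inter> X closure_of {x} - ?T"
    then have yX: "y \<in> topspace X" using S(2) by blast
    then have "x \<in> X closure_of {y}"
      using y mem_closure_of_singleton[of y X] by blast
    then show "y \<in> {x}"
      using zariski_space_T0[OF zariski x yX] y by blast
  qed
qed

text \<open>Strict inclusion of closed sets is well-founded, because an infinite strictly descending
  chain would never become constant.\<close>

lemma noetherian_space_induct [consumes 2, case_names less]:
  assumes "noetherian_space X" "closedin X C"
    and step: "\<And>C. closedin X C \<Longrightarrow> (\<And>D. closedin X D \<Longrightarrow> D \<subset> C \<Longrightarrow> P D) \<Longrightarrow> P C"
  shows "P C"
proof -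
  let ?r = "{(D, C). closedin X D \<and> closedin X C \<and> D \<subset> C}"
  have "wf ?r"
    unfolding wf_iff_no_infinite_down_chain
  proof
    assume "\<exists>f. \<forall>i::nat. (f (Suc i), f i) \<in> ?r"
    then obtain f :: "nat \<Rightarrow> 'a set" where "\<forall>i. (f (Suc i), f i) \<in> ?r"
      by blast
    then have f: "closedin X (f i)" "f (Suc i) \<subset> f i" for i
      by simp_all
    then have "decseq f"
      by (intro decseq_SucI) blast
    then obtain N where "\<forall>n\<ge>N. f n = f N"
      using assms(1) f(1) unfolding noetherian_space_def by blast
    then show False
      using f(2)[of N] by (metis le_Suc_eq order_refl psubset_eq)
  qed
  then have "closedin X C \<longrightarrow> P C"
    by (rule wf_induct_rule) (use step in blast)
  then show ?thesis using assms(2) by blast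
qed

text \<open>For a finite set of points, the masses are the measures of disjoint Borel sets, so every
  partial sum of \<open>c\<close> is bounded by the bound \<open>K\<close> of \<open>\<mu>\<close>.
  This bounds the sums of absolute values uniformly.\<close>

lemma point_masses_summable:
  assumes zariski: "zariski_space X" and fsm: "finite_signed_measure (borel_space_of X) \<mu>"
    and Z: "\<And>x. x \<in> topspace X \<Longrightarrow> Z x \<in> closed_sigma_avoiding X x"
    and mass: "\<And>x Z' A. x \<in> topspace X \<Longrightarrow> Z' \<in> closed_sigma_avoiding X x \<Longrightarrow>
      A \<in> sets (borel_space_of X) \<Longrightarrow> Z x \<subseteq> Z' \<Longrightarrow> A \<subseteq> X closure_of {x} \<Longrightarrow>
      \<mu> (A - Z') = (if x \<in> A then c x else 0)"
  shows "(\<lambda>x. \<bar>c x\<bar>) summable_on topspace X"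
proof -
  let ?M = "borel_space_of X"
  obtain K where K: "\<And>A. A \<in> sets ?M \<Longrightarrow> \<bar>\<mu> A\<bar> \<le> K"
    using finite_signed_measure_bounded[OF fsm] by blast
  have "(\<Sum>x\<in>F. \<bar>c x\<bar>) \<le> 2 * K" if F: "F \<subseteq> topspace X" "finite F" for F
  proof -
    \<comment> \<open>For distinct points of \<open>F\<close>, at least one is not in the closure of
      the other, say \<open>x\<close> not in that of \<open>y\<close>. Then \<open>T x\<close>
      contains the closure of \<open>y\<close>, which makes \<open>B x\<close> and
      \<open>B y\<close> disjoint.\<close>
    define T where "T x = Z x \<union> (\<Union>y\<in>{y\<in>F. x \<notin> X closure_of {y}}. X closure_of {y})" for x
    define B where "B x = X closure_of {x} - T x" for x
    have T: "T x \<in> closed_sigma_avoiding X x" if "x \<in> F" for x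
      unfolding T_def using that F Z
      by (intro closed_sigma_avoiding_Un closed_sigma_avoiding_UN)
         (auto intro: closed_sigma_avoiding_closedin countable_finite)
    have BM: "B x \<in> sets ?M" if "x \<in> F" for x
      unfolding B_def using T[OF that]
      by (intro sets.Diff closed_sigma_avoiding_borel closedin_borel_space_of) auto
    have \<mu>B: "\<mu> (B x) = c x" if "x \<in> F" for x
    proof -
      have "x \<in> topspace X" using that F by blast
      moreover have "Z x \<subseteq> T x" by (auto simp: T_def)
      ultimately show ?thesis
        unfolding B_def using mass[of x "T x" "X closure_of {x}"] T[OF that]
          mem_closure_of_singleton[of x X] closedin_borel_space_of[of X "X closure_of {x}"]
        by simp
    qed
    have disj: "B x \<inter> B y = {}" if xy: "x \<in> F" "y \<in> F" "x \<noteq> y" for x y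
    proof -
      have "x \<notin> X closure_of {y} \<or> y \<notin> X closure_of {x}"
        using zariski_space_T0[OF zariski] xy F by blast
      then show ?thesis
        using xy by (auto simp: B_def T_def)
    qed
    have part: "\<bar>\<Sum>x\<in>G. c x\<bar> \<le> K" if G: "G \<subseteq> F" for G
    proof -
      have "finite G" using G F finite_subset by blast
      have "\<mu> (\<Union>x\<in>G. B x) = (\<Sum>x\<in>G. \<mu> (B x))"
      proof (rule finite_signed_measure_finite_UN[OF fsm \<open>finite G\<close>])
        show "B x \<in> sets ?M" if "x \<in> G" for x using that G BM by blast
        show "disjoint_family_on B G"
          using G disj by (simp add: disjoint_family_on_def subset_iff)
      qed
      also have "\<dots> = (\<Sum>x\<in>G. c x)"
        using G \<mu>B by (intro sum.cong) auto
      finally have "(\<Sum>x\<in>G. c x) = \<mu> (\<Union>x\<in>G. B x)" ..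
      moreover have "(\<Union>x\<in>G. B x) \<in> sets ?M"
        using G BM \<open>finite G\<close> by (intro sets.finite_UN) auto
      ultimately show ?thesis
        using K by simp
    qed
    \<comment> \<open>Splitting by sign turns the absolute sum into two partial sums of
      \<open>c\<close>, each at most \<open>K\<close> in absolute value.\<close>
    let ?P = "{x\<in>F. 0 \<le> c x}"
    have "(\<Sum>x\<in>F. \<bar>c x\<bar>) = (\<Sum>x\<in>?P. \<bar>c x\<bar>) + (\<Sum>x\<in>F - ?P. \<bar>c x\<bar>)"
      using sum.subset_diff[of ?P F "\<lambda>x. \<bar>c x\<bar>"] F by (simp add: add.commute)
    also have "(\<Sum>x\<in>?P. \<bar>c x\<bar>) = (\<Sum>x\<in>?P. c x)"
      by (intro sum.cong) auto
    also have "(\<Sum>x\<in>F - ?P. \<bar>c x\<bar>) = - (\<Sum>x\<in>F - ?P. c x)"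
      unfolding sum_negf[symmetric] by (intro sum.cong) auto
    finally show ?thesis
      using part[of ?P] part[of "F - ?P"] by fastforce
  qed
  then show ?thesis
    by (intro nonneg_bdd_above_summable_on) (auto intro!: bdd_aboveI[of _ "2 * K"])
qed

text \<open>The difference \<open>\<nu>\<close> between \<open>\<mu>\<close> and the sum of the
  point masses is again a finite signed measure. Noetherian induction shows that it vanishes on the
  Borel subsets of every closed set, in particular of the whole space.\<close>

lemma point_masses_total:
  assumes zariski: "zariski_space X" and fsm: "finite_signed_measure (borel_space_of X) \<mu>"
    and Z: "\<And>x. x \<in> topspace X \<Longrightarrow> Z x \<in> closed_sigma_avoiding X x"
    and mass: "\<And>x Z' A. x \<in> topspace X \<Longrightarrow> Z' \<in> closed_sigma_avoiding X x \<Longrightarrow>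
      A \<in> sets (borel_space_of X) \<Longrightarrow> Z x \<subseteq> Z' \<Longrightarrow> A \<subseteq> X closure_of {x} \<Longrightarrow>
      \<mu> (A - Z') = (if x \<in> A then c x else 0)"
    and abs_summable: "(\<lambda>x. \<bar>c x\<bar>) summable_on topspace X"
    and A: "A \<in> sets (borel_space_of X)"
  shows "\<mu> A = infsum c A"
proof -
  let ?M = "borel_space_of X"
  define \<nu> where "\<nu> A = \<mu> A - infsum c A" for A
  define S where "S = {x \<in> topspace X. c x \<noteq> 0}"
  have countable: "countable S"
    using abs_summable_countable[of c "topspace X"] abs_summable by (simp add: S_def)
  have "c summable_on topspace X"
    using abs_summable by (simp add: abs_summable_on_real_iff)
  then have fsm\<nu>: "finite_signed_measure ?M \<nu>"
    unfolding \<nu>_def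
    by (intro finite_signed_measure_diff fsm finite_signed_measure_infsum)
       (simp add: space_borel_space_of)
  \<comment> \<open>The claim covers all Borel subsets of \<open>C\<close>, not just
    \<open>C\<close>, because the induction hypothesis is applied to pieces of \<open>A\<close> in
    smaller closed sets.\<close>
  have "\<forall>A\<in>sets ?M. A \<subseteq> C \<longrightarrow> \<nu> A = 0" if "closedin X C" for C
  proof (rule noetherian_space_induct[of X C])
    show "noetherian_space X" using zariski by (simp add: zariski_space_def)
    show "closedin X C" by fact
    fix C assume C: "closedin X C"
      and IH: "\<And>D. closedin X D \<Longrightarrow> D \<subset> C \<Longrightarrow> \<forall>A\<in>sets ?M. A \<subseteq> D \<longrightarrow> \<nu> A = 0"
    consider "C = {}"
      | E1 E2 where "closedin X E1" "closedin X E2" "E1 \<subset> C" "E2 \<subset> C" "C = E1 \<union> E2"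
      | x where "x \<in> C" "X closure_of {x} = C"
    proof (cases "irreducible_closedin X C \<and> C \<noteq> {}")
      case True
      then have "\<exists>x. x \<in> C \<and> X closure_of {x} = C"
        using zariski unfolding zariski_space_def by (meson ex1_implies_ex)
      then show ?thesis using that(3) by blast
    next
      case False
      then show ?thesis
        using C that(1,2) unfolding irreducible_closedin_def by metis
    qed
    then show "\<forall>A\<in>sets ?M. A \<subseteq> C \<longrightarrow> \<nu> A = 0"
    proof cases
      case 1
      then show ?thesis using finite_signed_measure_empty[OF fsm\<nu>] by auto
    next
      case 2
      show ?thesis
      proof (intro ballI impI)
        fix A assume A: "A \<in> sets ?M" "A \<subseteq> C"
        have E1: "E1 \<in> sets ?M" using 2 by (intro closedin_borel_space_of)
        have "\<nu> (A \<inter> E1) = 0"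
          using IH[OF 2(1,3)] sets.Int[OF A(1) E1] by simp
        moreover have "A - E1 \<subseteq> E2" using A(2) 2(5) by blast
        then have "\<nu> (A - E1) = 0"
          using IH[OF 2(2,4)] sets.Diff[OF A(1) E1] by simp
        ultimately show "\<nu> A = 0"
          using finite_signed_measure_split[OF fsm\<nu> A(1) E1] by simp
      qed
    next
      case 3
      have x: "x \<in> topspace X" using 3 C closedin_subset by blast
      \<comment> \<open>\<open>T0\<close> removes from \<open>C\<close> every point with nonzero
        coefficient except possibly \<open>x\<close>; this uses that the support of a summable
        family is countable. Adding \<open>Z x\<close> makes \<open>mass\<close> applicable to
        \<open>T\<close>.\<close>
      obtain T0 where T0: "T0 \<in> closed_sigma_avoiding X x" "S \<inter> C - T0 \<subseteq> {x}"
        using zariski_space_isolate_point[OF zariski x countable] 3(2) S_def by blast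
      define T where "T = Z x \<union> T0"
      have T: "T \<in> closed_sigma_avoiding X x"
        unfolding T_def using Z[OF x] T0(1) by (rule closed_sigma_avoiding_Un)
      have TM: "T \<in> sets ?M"
        using T by (rule closed_sigma_avoiding_borel)
      have xT: "x \<notin> T"
        using T by (auto simp: closed_sigma_avoiding_def)
      obtain \<F> where \<F>: "T = \<Union>\<F>" "countable \<F>" "\<And>F. F \<in> \<F> \<Longrightarrow> closedin X F \<and> x \<notin> F"
        using T unfolding closed_sigma_avoiding_def by blast
      show ?thesis
      proof (intro ballI impI)
        fix A assume A: "A \<in> sets ?M" "A \<subseteq> C"
        \<comment> \<open>Since \<open>x\<close> lies in \<open>C\<close> but in no
          \<open>F\<close>, each \<open>F \<inter> C\<close> is a proper closed subset of
          \<open>C\<close>. The induction hypothesis makes these countably many pieces null,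
          together with all their Borel subsets.\<close>
        have "\<nu> (A \<inter> T) = 0"
        proof (rule finite_signed_measure_null_Union[OF fsm\<nu>, of "(\<lambda>F. F \<inter> C) ` \<F>"])
          show "countable ((\<lambda>F. F \<inter> C) ` \<F>)" using \<F>(2) by simp
          show "(\<lambda>F. F \<inter> C) ` \<F> \<subseteq> sets ?M"
            using \<F>(3) C by (auto intro!: closedin_borel_space_of closedin_Int)
          show "A \<inter> T \<in> sets ?M" using A TM by auto
          show "A \<inter> T \<subseteq> \<Union>((\<lambda>F. F \<inter> C) ` \<F>)" using \<F>(1) A by auto
          fix F B assume FB: "F \<in> (\<lambda>F. F \<inter> C) ` \<F>" "B \<in> sets ?M" "B \<subseteq> F"
          then have "closedin X F" "F \<subset> C"
            using \<F>(3) C 3(1) by (auto intro: closedin_Int)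
          then show "\<nu> B = 0" using IH FB by blast
        qed
        \<comment> \<open>Outside \<open>T\<close> only \<open>x\<close> can carry a coefficient, so
          both the sum and \<open>\<mu>\<close> give \<open>c x\<close> or 0 according to whether
          \<open>x\<close> is in \<open>A\<close>.\<close>
        moreover have "\<nu> (A - T) = 0"
        proof -
          have "c y = 0" if y: "y \<in> A - T" "y \<noteq> x" for y
          proof -
            have "y \<in> topspace X"
              using y(1) subset_topspace_borel_space_of[OF A(1)] by blast
            then show ?thesis
              using T0(2) y A(2) by (auto simp: S_def T_def)
          qed
          then have "infsum c (A - T) = infsum c ((A - T) \<inter> {x})"
            by (intro infsum_cong_neutral) auto
          also have "\<dots> = (if x \<in> A then c x else 0)"
            using xT by auto
          also have "\<dots> = \<mu> (A - T)"
            using mass[OF x T A(1)] A(2) 3(2) by (simp add: T_def)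
          finally show ?thesis by (simp add: \<nu>_def)
        qed
        ultimately show "\<nu> A = 0"
          using finite_signed_measure_split[OF fsm\<nu> A(1) TM] by simp
      qed
    qed
  qed
  from this[of "topspace X"] show ?thesis
    using A subset_topspace_borel_space_of by (force simp: \<nu>_def)
qed

text \<open>This gives uniqueness, applied to the difference of two coefficient families. Although
  \<open>{x}\<close> may fail to be Borel, removing a suitable exceptional set from the closure of
  \<open>x\<close> leaves a Borel set whose only possible support point is \<open>x\<close>.\<close>

lemma infsum_borel_eq_0_imp_eq_0:
  assumes zariski: "zariski_space X" and c: "(\<lambda>x. \<bar>c x\<bar>) summable_on topspace X"
    and zero: "\<And>A. A \<in> sets (borel_space_of X) \<Longrightarrow> infsum c A = 0"
    and x: "x \<in> topspace X"
  shows "c x = (0::real)"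
proof -
  define S where "S = {x \<in> topspace X. c x \<noteq> 0}"
  have countable: "countable S"
    using abs_summable_countable[of c "topspace X"] c by (simp add: S_def)
  obtain T where T: "T \<in> closed_sigma_avoiding X x" "S \<inter> X closure_of {x} - T \<subseteq> {x}"
    using zariski_space_isolate_point[OF zariski x countable] S_def by blast
  have xE: "x \<in> X closure_of {x} - T"
    using x T(1) mem_closure_of_singleton[of x X] by (auto simp: closed_sigma_avoiding_def)
  have "c y = 0" if y: "y \<in> X closure_of {x} - T" "y \<noteq> x" for y
  proof -
    have "y \<in> topspace X"
      using y(1) closure_of_subset_topspace[of X "{x}"] by blast
    then show ?thesis
      using T(2) y by (auto simp: S_def)
  qed
  then have "infsum c (X closure_of {x} - T) = infsum c {x}"
    using xE by (intro infsum_cong_neutral) auto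
  moreover have "X closure_of {x} - T \<in> sets (borel_space_of X)"
    using closed_sigma_avoiding_borel[OF T(1)] closedin_borel_space_of[of X "X closure_of {x}"]
    by (intro sets.Diff) auto
  ultimately show ?thesis
    using zero by simp
qed

section \<open>Existence and uniqueness of the Dirac representation\<close>

lemma has_sum_dirac_iff:
  assumes "E \<in> sets (borel_space_of X)"
  shows "((\<lambda>x. c x * measure (return (borel_space_of X) x) E) has_sum s) (topspace X) \<longleftrightarrow>
    (c has_sum s) E"
  using subset_topspace_borel_space_of[OF assms] measure_return[OF assms]
  by (intro has_sum_cong_neutral) auto

theorem theoremA:
  fixes X :: "'a topology" and \<mu> :: "'a set \<Rightarrow> real"
  assumes "zariski_space X"
    and "finite_signed_measure (borel_space_of X) \<mu>"
  shows "\<exists>!c. c \<in> extensional (topspace X) \<and>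
           (\<lambda>x. \<bar>c x\<bar>) summable_on topspace X \<and>
           (\<forall>E \<in> sets (borel_space_of X).
              ((\<lambda>x. c x * measure (return (borel_space_of X) x) E) has_sum \<mu> E) (topspace X))"
proof -
  let ?M = "borel_space_of X"
  \<comment> \<open>The Dirac mass of \<open>E\<close> is its indicator, so the weighted sum over
    the space is the sum of \<open>c\<close> over \<open>E\<close>. Extensionality fixes the values
    off the space at \<open>undefined\<close>, so that uniqueness holds for total functions.\<close>
  define good where "good c \<longleftrightarrow> c \<in> extensional (topspace X) \<and>
    (\<lambda>x. \<bar>c x\<bar>) summable_on topspace X \<and> (\<forall>E \<in> sets ?M. (c has_sum \<mu> E) E)" for c
  have summable: "c summable_on E"
    if "(\<lambda>x. \<bar>c x\<bar>) summable_on topspace X" "E \<in> sets ?M" for c :: "'a \<Rightarrow> real" and E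
  proof -
    have "c summable_on topspace X"
      using that(1) by (simp add: abs_summable_on_real_iff)
    then show ?thesis
      using subset_topspace_borel_space_of[OF that(2)] by (rule summable_on_subset_banach)
  qed
  have "\<exists>!c. good c"
  proof (rule ex_ex1I)
    define P where "P x c Z \<longleftrightarrow> Z \<in> closed_sigma_avoiding X x \<and>
        (\<forall>Z'\<in>closed_sigma_avoiding X x. \<forall>A\<in>sets ?M. Z \<subseteq> Z' \<and> A \<subseteq> X closure_of {x} \<longrightarrow>
          \<mu> (A - Z') = (if x \<in> A then c else 0))" for x c Z
    have "\<exists>c Z. P x c Z" if "x \<in> topspace X" for x
      unfolding P_def using assms(2) that by (rule point_mass_exists)
    then obtain c Z where P: "\<And>x. x \<in> topspace X \<Longrightarrow> P x (c x) (Z x)"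
      by metis
    have Z: "Z x \<in> closed_sigma_avoiding X x" if "x \<in> topspace X" for x
      using P[OF that] by (simp add: P_def)
    have mass: "\<mu> (A - Z') = (if x \<in> A then c x else 0)"
      if "x \<in> topspace X" "Z' \<in> closed_sigma_avoiding X x" "A \<in> sets ?M" "Z x \<subseteq> Z'"
        "A \<subseteq> X closure_of {x}" for x Z' A
      using P[OF that(1)] that(2-) by (simp add: P_def)
    have c: "(\<lambda>x. \<bar>c x\<bar>) summable_on topspace X"
      by (rule point_masses_summable[OF assms Z mass])
    have "(c has_sum \<mu> E) E" if E: "E \<in> sets ?M" for E
    proof -
      have "\<mu> E = infsum c E"
        by (rule point_masses_total[OF assms Z mass c E])
      then show ?thesis
        using has_sum_infsum[OF summable[OF c E]] by simp
    qed
    \<comment> \<open>The chosen \<open>c\<close> is arbitrary off the space. Restricting it makes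
      it extensional and changes no sum, as Borel sets lie in the space.\<close>
    then have "(restrict c (topspace X) has_sum \<mu> E) E" if "E \<in> sets ?M" for E
      using that subset_topspace_borel_space_of[OF that]
      by (subst has_sum_cong[where g = c]) auto
    moreover have "(\<lambda>x. \<bar>restrict c (topspace X) x\<bar>) summable_on topspace X"
      using c by (subst summable_on_cong[where g = "\<lambda>x. \<bar>c x\<bar>"]) auto
    ultimately show "\<exists>c. good c"
      unfolding good_def by (intro exI[of _ "restrict c (topspace X)"]) auto
  next
    fix c d assume cd: "good c" "good d"
    have "c x - d x = 0" if "x \<in> topspace X" for x
    proof (rule infsum_borel_eq_0_imp_eq_0[OF assms(1) _ _ that, of "\<lambda>x. c x - d x"])
      have diff: "((\<lambda>x. c x - d x) has_sum 0) A" if "A \<in> sets ?M" for A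
        using has_sum_add[of c A "\<mu> A" "\<lambda>x. - d x" "- \<mu> A"] cd that
        by (simp add: good_def has_sum_uminus)
      \<comment> \<open>The whole space is Borel, so \<open>diff\<close> gives summability there,
        which for real families is absolute.\<close>
      have "(\<lambda>x. c x - d x) summable_on topspace X"
        by (rule has_sum_imp_summable[OF diff]) (simp add: closedin_borel_space_of)
      then show "(\<lambda>x. \<bar>c x - d x\<bar>) summable_on topspace X"
        by (simp add: abs_summable_on_real_iff)
      fix A assume "A \<in> sets ?M"
      then have "((\<lambda>x. c x - d x) has_sum 0) A"
        by (rule diff)
      then show "(\<Sum>\<^sub>\<infinity>x\<in>A. c x - d x) = 0"
        by (simp add: infsumI)
    qed
    then show "c = d"
      using cd by (intro extensionalityI[of c "topspace X" d]) (auto simp: good_def)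
  qed
  then show ?thesis
    by (simp add: good_def has_sum_dirac_iff cong: ball_cong)
qed

end
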